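(* For every non-negative integer $k$, there exists a $P_4$-free circulant that is not $k$-paired.
   Context: Graphs are finite, undirected, without loops or multiple edges. For a positive integer $n$ write $[n]=\{1,\dots,n\}$, and $[0]=\emptyset$. Given a positive integer $n$ and a set $D\subseteq[n-1]$ such that $d\in D\Leftrightarrow n-d\in D$, the circulant $C_n(D)$ is the graph with vertex set $\mathbb{Z}_n$ in which two distinct vertices $i,j$ are adjacent if and only if $i-j \pmod n\in D$. For a non-negative integer $k$, a circulant $C_n(D)$ is $k$-paired if there exist $k$ ordered pairs of positive integers $(a_1,b_1),\dots,(a_k,b_k)$ such that $a_ib_i\mid n$ for all $i\in[k]$ and $D=\bigcup_{i=1}^k D_i$, where $D_i=\{d\in[n-1] : a_i\mid d \text{ and } a_ib_i\nmid d\}$ (for $k=0$, $D=\emptyset$). Repetition of pairs and the pair $(1,1)$ are allowed. $P_4$ is the path on $4$ vertices; a graph is $P_4$-free if no induced subgraph of it is isomorphic to $P_4$. *)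

theory Defs
  imports "Graph_Theory.Pair_Digraph" "Graph_Theory.Digraph_Isomorphism"
begin

definition connection_set :: "nat \<Rightarrow> nat set \<Rightarrow> bool" where
  "connection_set n D \<longleftrightarrow> D \<subseteq> {1..n-1} \<and> (\<forall>d\<in>{1..n-1}. d \<in> D \<longleftrightarrow> n - d \<in> D)"

text \<open>An undirected simple graph is a \<^locale>\<open>pair_graph\<close>, that is, a finite symmetric loop-free
  digraph whose arcs are ordered pairs of vertices. The vertex set \<open>\<int>\<^sub>n\<close> is represented by the
  least non-negative residues.\<close>

definition circulant :: "nat \<Rightarrow> nat set \<Rightarrow> int pair_pre_digraph" where
  "circulant n D =
     \<lparr>pverts = {0..<int n},
      parcs = {(i, j). i \<in> {0..<int n} \<and> j \<in> {0..<int n} \<and> i \<noteq> j \<and> nat ((i - j) mod int n) \<in> D}\<rparr>"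

lemma pair_graph_circulant:
  assumes "connection_set n D"
  shows "pair_graph (circulant n D)"
proof
  show "finite (pverts (circulant n D))"
    by (simp add: circulant_def)
  show "finite (parcs (circulant n D))"
    by (rule finite_subset[of _ "{0..<int n} \<times> {0..<int n}"]) (auto simp: circulant_def)
  show "fst e \<in> pverts (circulant n D)" "snd e \<in> pverts (circulant n D)"
    "fst e \<noteq> snd e" if "e \<in> parcs (circulant n D)" for e
    using that by (auto simp: circulant_def)
  have "(j, i) \<in> parcs (circulant n D)" if "(i, j) \<in> parcs (circulant n D)" for i j
  proof -
    from that have ij: "0 \<le> i" "i < int n" "0 \<le> j" "j < int n" "i \<noteq> j"
      and D: "nat ((i - j) mod int n) \<in> D" by (auto simp: circulant_def)
    let ?d = "nat ((i - j) mod int n)"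
    have "(i - j) mod int n \<noteq> 0"
      using ij by (metis mod_eq_dvd_iff mod_pos_pos_trivial mod_0_imp_dvd)
    then have "(j - i) mod int n = int n - (i - j) mod int n"
      using zmod_zminus1_eq_if[of "i - j" "int n"] by simp
    then have "nat ((j - i) mod int n) = n - ?d"
      using ij pos_mod_sign[of "int n" "i - j"] by (simp add: nat_diff_distrib')
    moreover have "n - ?d \<in> D"
      using D assms by (auto simp: connection_set_def)
    ultimately show ?thesis using ij by (auto simp: circulant_def)
  qed
  then show "symmetric (with_proj (circulant n D))"
    by (auto simp: symmetric_def sym_def)
qed

definition path_graph :: "nat \<Rightarrow> nat pair_pre_digraph" where
  "path_graph m =
     \<lparr>pverts = {0..<m},
      parcs = {(i, j). i \<in> {0..<m} \<and> j \<in> {0..<m} \<and> (i = Suc j \<or> j = Suc i)}\<rparr>"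

lemma pair_graph_path_graph: "pair_graph (path_graph m)"
proof
  show "finite (pverts (path_graph m))"
    by (simp add: path_graph_def)
  show "finite (parcs (path_graph m))"
    by (rule finite_subset[of _ "{0..<m} \<times> {0..<m}"]) (auto simp: path_graph_def)
  show "fst e \<in> pverts (path_graph m)" "snd e \<in> pverts (path_graph m)" "fst e \<noteq> snd e"
    if "e \<in> parcs (path_graph m)" for e
    using that by (auto simp: path_graph_def)
  show "symmetric (with_proj (path_graph m))"
    by (auto simp: symmetric_def sym_def path_graph_def)
qed

definition P4_free :: "'a pair_pre_digraph \<Rightarrow> bool" where
  "P4_free G \<longleftrightarrow>
     \<not> (\<exists>H. induced_subgraph H (with_proj G) \<and> digraph_iso H (with_proj (path_graph 4)))"

definition pair_differences :: "nat \<Rightarrow> nat \<Rightarrow> nat \<Rightarrow> nat set" where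
  "pair_differences n a b = {d \<in> {1..n-1}. a dvd d \<and> \<not> a * b dvd d}"

text \<open>Being \<open>k\<close>-paired is a property of the data \<open>(n, D)\<close>, which the labelled graph
  \<open>circulant n D\<close> determines; the definition does not range over isomorphic circulants.\<close>

definition k_paired :: "nat \<Rightarrow> nat \<Rightarrow> nat set \<Rightarrow> bool" where
  "k_paired k n D \<longleftrightarrow>
     (\<exists>a b :: nat \<Rightarrow> nat.
        (\<forall>i\<in>{1..k}. 0 < a i \<and> 0 < b i \<and> a i * b i dvd n) \<and>
        D = (\<Union>i\<in>{1..k}. pair_differences n (a i) (b i)))"

end

theory Submission
  imports Defs "HOL-Computational_Algebra.Primes"
begin

text \<open>
  Fix \<open>p > 1\<close>, let the valuation of a nonzero integer be the largest \<open>e\<close> such that \<open>p\<^sup>e\<close> divides it,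
  and in the circulant on \<open>p\<^sup>m\<close> vertices let adjacency of \<open>i\<close> and \<open>j\<close> depend only on whether the
  valuation of \<open>i - j\<close> lies in a prescribed set \<open>S\<close>. Divisibility of differences by \<open>p\<^sup>e\<close> is
  transitive, so distances of this kind are ultrametric: in every triangle the smallest valuation
  occurs at least twice. An induced path on four vertices contradicts this
  (\<open>ultrametric_no_induced_P4\<close>). Hence every such circulant is \<open>P\<^sub>4\<close>-free, whatever \<open>S\<close> is
  (\<open>P4_free_valuation_circulant\<close>).

  On the other hand, the differences prescribed by one pair \<open>(a, b)\<close> are convex for divisibility:
  if \<open>x\<close> and \<open>z\<close> belong to them and \<open>x\<close> divides \<open>y\<close> and \<open>y\<close> divides \<open>z\<close>, then so does \<open>y\<close>. If
  \<open>S\<close> consists of the even numbers, then no two of the powers \<open>1, p\<^sup>2, p\<^sup>4, \<dots>, p\<^bsup>2k\<^esup>\<close> come from the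
  same pair, since an odd power of \<open>p\<close> lies between them. These are \<open>k + 1\<close> differences, so \<open>k\<close>
  pairs do not suffice (\<open>even_valuation_not_k_paired\<close>).
\<close>

section \<open>Ultrametrics and induced paths\<close>

text \<open>
  In the triangles \<open>a b c\<close> and \<open>b c d\<close> exactly one side, \<open>a c\<close> respectively \<open>b d\<close>, has its valuation
  outside \<open>S\<close>, so that side is the odd one out and has the strictly largest valuation. Thus all
  edges of the path have the same valuation, and it is smaller than that of \<open>b d\<close>. The triangle
  \<open>a b d\<close> then gives \<open>a d\<close> this valuation too, although \<open>a d\<close> is not an edge.
\<close>

lemma ultrametric_no_induced_P4:
  fixes v :: "'a \<Rightarrow> 'a \<Rightarrow> 'b::linorder"
  assumes sym: "\<And>x y. v x y = v y x"
    and isosceles: "\<And>x y z. x \<noteq> y \<Longrightarrow> v x y < v y z \<Longrightarrow> v x z = v x y"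
    and distinct: "distinct [a, b, c, d]"
    and edges: "v a b \<in> S" "v b c \<in> S" "v c d \<in> S"
    and non_edges: "v a c \<notin> S" "v b d \<notin> S" "v a d \<notin> S"
  shows False
proof -
  have "\<not> v a b < v b c" "\<not> v c b < v b a"
    using isosceles[of a b c] isosceles[of c b a] sym[of a c] sym[of b c] distinct edges non_edges
    by auto
  then have "v a b = v b c"
    using sym[of a b] sym[of b c] by auto
  moreover have "\<not> v d b < v b c"
    using isosceles[of d b c] sym[of c d] sym[of b d] distinct edges non_edges by auto
  then have "v b c < v b d"
    using sym[of b d] edges non_edges by (cases "v b c" "v b d" rule: linorder_cases) auto
  ultimately show False
    using isosceles[of a b d] distinct edges non_edges by auto
qed

text \<open>
  The vertices \<open>a, b, c, d\<close> are the preimages of \<open>0, 1, 2, 3\<close> under an isomorphism from an induced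
  subgraph to the path. The non-arcs of the path transfer because the subgraph is induced.
\<close>

lemma P4_freeI:
  assumes "\<And>a b c d. {a, b, c, d} \<subseteq> pverts G \<Longrightarrow> distinct [a, b, c, d] \<Longrightarrow>
    (a, b) \<in> parcs G \<Longrightarrow> (b, c) \<in> parcs G \<Longrightarrow> (c, d) \<in> parcs G \<Longrightarrow>
    (a, c) \<notin> parcs G \<Longrightarrow> (b, d) \<notin> parcs G \<Longrightarrow> (a, d) \<notin> parcs G \<Longrightarrow> False"
  shows "P4_free G"
  unfolding P4_free_def
proof (rule notI, elim exE conjE)
  fix H assume H: "induced_subgraph H (with_proj G)"
    and "digraph_iso H (with_proj (path_graph 4))"
  then obtain f where f: "pre_digraph.digraph_isomorphism H f"
    and P: "with_proj (path_graph 4) = app_iso f H"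
    by (auto simp: digraph_iso_def)
  interpret wf_digraph H
    using f by (simp add: pre_digraph.digraph_isomorphism_def)
  have ends: "arcs_ends H = {(x, y) \<in> parcs G. x \<in> verts H \<and> y \<in> verts H}"
    using H by (auto simp: induced_subgraph_def subgraph_def compatible_def arcs_ends_conv)
  have inj: "inj_on (iso_verts f) (verts H)"
    using f by (rule digraph_isomorphism_inj_on_verts)
  have adj: "(x, y) \<in> parcs G \<longleftrightarrow> (iso_verts f x, iso_verts f y) \<in> parcs (path_graph 4)"
    if "x \<in> verts H" "y \<in> verts H" for x y
  proof -
    have "parcs (path_graph 4) = map_prod (iso_verts f) (iso_verts f) ` arcs_ends H"
      using arcs_ends_app_iso_eq[OF f] P[symmetric] by (simp add: map_prod_def)
    moreover have "arcs_ends H \<subseteq> verts H \<times> verts H"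
      using ends by auto
    ultimately show ?thesis
      using that ends inj by (auto simp: inj_on_eq_iff)
  qed
  have "iso_verts f ` verts H = {0..<4}"
    using arg_cong[OF P, of verts] by (simp add: path_graph_def)
  then have "\<exists>x \<in> verts H. iso_verts f x = i" if "i < 4" for i
    using that by (metis atLeastLessThan_iff imageE zero_le)
  then obtain w where w: "w i \<in> verts H" "iso_verts f (w i) = i" if "i < 4" for i
    by metis
  have arcs: "(w i, w j) \<in> parcs G \<longleftrightarrow> i = Suc j \<or> j = Suc i" if "i < 4" "j < 4" for i j
    using adj[OF w(1) w(1)] that w(2) by (simp add: path_graph_def)
  have "verts H \<subseteq> pverts G"
    using H by (auto simp: induced_subgraph_def subgraph_def)
  moreover have "w i = w j \<longleftrightarrow> i = j" if "i < 4" "j < 4" for i j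
    using w(2) that by metis
  ultimately show False
    using assms[of "w 0" "w 1" "w 2" "w 3"] w(1) by (simp add: arcs subset_iff)
qed

section \<open>Circulants defined by a valuation\<close>

definition valuation_set :: "nat \<Rightarrow> nat \<Rightarrow> nat set \<Rightarrow> nat set" where
  "valuation_set p m S = {d \<in> {1..p ^ m - 1}. multiplicity (int p) (int d) \<in> S}"

lemma multiplicity_minus: "multiplicity p (- x) = multiplicity p x" for p x :: int
  using multiplicity_times_unit_right[of "- 1" p x] by simp

text \<open>
  The difference \<open>x - z\<close> is the sum of \<open>x - y\<close>, of valuation \<open>e\<close> say, and a multiple of
  \<open>p\<^bsup>e + 1\<^esup>\<close>. The points \<open>x\<close> and \<open>y\<close> have to differ because \<open>multiplicity p 0\<close> is \<open>0\<close> by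
  default, where the valuation of \<open>0\<close> would be infinite.
\<close>

lemma multiplicity_diff_isosceles:
  fixes p x y z :: int
  assumes "\<not> is_unit p" "x \<noteq> y" "multiplicity p (x - y) < multiplicity p (y - z)"
  shows "multiplicity p (x - z) = multiplicity p (x - y)"
proof (rule multiplicity_eqI)
  let ?c = "multiplicity p (x - y)"
  have sum: "x - z = (x - y) + (y - z)"
    by simp
  show "p ^ ?c dvd x - z"
    unfolding sum using assms(3) by (intro dvd_add multiplicity_dvd') auto
  have "\<not> p ^ Suc ?c dvd x - y"
    using assms by (subst power_dvd_iff_le_multiplicity) auto
  moreover have "p ^ Suc ?c dvd y - z"
    using assms(3) by (intro multiplicity_dvd') simp
  ultimately show "\<not> p ^ Suc ?c dvd x - z"
    unfolding sum by (simp only: dvd_add_left_iff not_False_eq_True)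
qed

text \<open>
  The valuation is well defined on nonzero residues modulo \<open>p\<^sup>m\<close>: only powers dividing \<open>p\<^sup>m\<close> are
  relevant to it, and these cannot tell \<open>x\<close> from \<open>x mod p\<^sup>m\<close>.
\<close>

lemma multiplicity_mod_power:
  fixes p x :: int
  assumes "\<not> p ^ m dvd x"
  shows "multiplicity p (x mod p ^ m) = multiplicity p x"
proof (rule multiplicity_eqI)
  have x: "x \<noteq> 0" "\<not> is_unit p"
    using assms unit_imp_dvd[of "p ^ m" x] by (auto simp: is_unit_power_iff simp del: zdvd1_eq)
  have less: "multiplicity p x < m"
    using assms x by (simp add: power_dvd_iff_le_multiplicity)
  show "p ^ multiplicity p x dvd x mod p ^ m"
    using less by (subst dvd_mod_iff) (auto intro: le_imp_power_dvd multiplicity_dvd)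
  have "\<not> p ^ Suc (multiplicity p x) dvd x"
    using x by (subst power_dvd_iff_le_multiplicity) auto
  then show "\<not> p ^ Suc (multiplicity p x) dvd x mod p ^ m"
    using less by (subst dvd_mod_iff) (auto intro: le_imp_power_dvd simp del: power_Suc)
qed

lemma connection_set_valuation_set: "connection_set (p ^ m) (valuation_set p m S)"
proof -
  have "multiplicity (int p) (int (p ^ m - d)) = multiplicity (int p) (int d)"
    if d: "d \<in> {1..p ^ m - 1}" for d
  proof -
    have "\<not> int p ^ m dvd int d"
      using d by (auto simp flip: of_nat_power dest: dvd_imp_le)
    moreover have "int (p ^ m - d) = (- int d) mod int p ^ m"
    proof -
      have "(- int d) mod int p ^ m = (int (p ^ m - d) - int p ^ m) mod int p ^ m"
        using d by auto
      moreover have "p ^ m - d < p ^ m"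
        using d by auto
      ultimately show ?thesis
        by (simp flip: of_nat_power of_nat_mod)
    qed
    ultimately show ?thesis
      by (simp add: multiplicity_mod_power multiplicity_minus)
  qed
  then show ?thesis
    by (auto simp: connection_set_def valuation_set_def)
qed

lemma parcs_valuation_circulant:
  assumes "i \<in> pverts (circulant (p ^ m) (valuation_set p m S))"
    and "j \<in> pverts (circulant (p ^ m) (valuation_set p m S))"
    and "i \<noteq> j"
  shows "(i, j) \<in> parcs (circulant (p ^ m) (valuation_set p m S)) \<longleftrightarrow>
    multiplicity (int p) (i - j) \<in> S"
proof -
  let ?n = "int p ^ m" and ?r = "(i - j) mod int p ^ m"
  have ij: "0 \<le> i" "i < ?n" "0 \<le> j" "j < ?n"
    using assms by (auto simp: circulant_def)
  have ndvd: "\<not> ?n dvd i - j"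
    using ij assms(3) by (metis mod_eq_dvd_iff mod_pos_pos_trivial)
  have "0 < ?n"
    using ij by linarith
  then have "0 \<le> ?r" "?r < ?n"
    by auto
  moreover have "?r \<noteq> 0"
    using ndvd by (simp add: dvd_eq_mod_eq_0)
  ultimately have "nat ?r \<in> {1..p ^ m - 1}"
    by (simp add: Suc_le_eq le_diff_conv2 flip: of_nat_power)
  then show ?thesis
    using assms ndvd \<open>0 \<le> ?r\<close>
    by (simp add: circulant_def valuation_set_def multiplicity_mod_power)
qed

lemma P4_free_valuation_circulant:
  assumes "1 < p"
  shows "P4_free (circulant (p ^ m) (valuation_set p m S))"
proof (rule P4_freeI)
  let ?G = "circulant (p ^ m) (valuation_set p m S)"
  let ?v = "\<lambda>i j. multiplicity (int p) (i - j)"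
  fix a b c d
  assume verts: "{a, b, c, d} \<subseteq> pverts ?G" and distinct: "distinct [a, b, c, d]"
    and "(a, b) \<in> parcs ?G" "(b, c) \<in> parcs ?G" "(c, d) \<in> parcs ?G"
      "(a, c) \<notin> parcs ?G" "(b, d) \<notin> parcs ?G" "(a, d) \<notin> parcs ?G"
  then have "?v a b \<in> S" "?v b c \<in> S" "?v c d \<in> S" "?v a c \<notin> S" "?v b d \<notin> S" "?v a d \<notin> S"
    by (simp_all add: parcs_valuation_circulant)
  moreover have "?v x y = ?v y x" for x y
    using multiplicity_minus[of "int p" "x - y"] by simp
  moreover have "\<not> is_unit (int p)"
    using assms by simp
  ultimately show False
    using ultrametric_no_induced_P4[of ?v a b c d S] multiplicity_diff_isosceles distinct
    by blast
qed

section \<open>Counting pairs\<close>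

lemma pair_differences_convex:
  assumes "x \<in> pair_differences n a b" "z \<in> pair_differences n a b"
    and "x dvd y" "y dvd z"
  shows "y \<in> pair_differences n a b"
proof -
  have "0 < z" "z < n"
    using assms(2) by (auto simp: pair_differences_def)
  then have "y \<le> z" "0 < y"
    using assms(4) by (auto intro: dvd_imp_le dvd_pos_nat)
  then show ?thesis
    using assms \<open>z < n\<close> by (auto simp: pair_differences_def intro: dvd_trans)
qed

text \<open>
  The exponent \<open>2 * k + 1\<close> of the order is the least for which all of \<open>1, p\<^sup>2, \<dots>, p\<^bsup>2k\<^esup>\<close> are
  differences; the pigeonhole principle assigns two of them to the same pair.
\<close>

lemma even_valuation_not_k_paired:
  assumes p: "1 < p"
  shows "\<not> k_paired k (p ^ (2 * k + 1)) (valuation_set p (2 * k + 1) {e. even e})"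
    (is "\<not> k_paired k ?n ?D")
proof
  assume "k_paired k ?n ?D"
  then obtain a b where D: "?D = (\<Union>i\<in>{1..k}. pair_differences ?n (a i) (b i))"
    by (auto simp: k_paired_def)
  have val: "p ^ e \<in> ?D \<longleftrightarrow> even e" if "e \<le> 2 * k" for e
  proof -
    have "p ^ e < ?n"
      using p that by (intro power_strict_increasing) auto
    then show ?thesis
      using p by (auto simp: valuation_set_def multiplicity_same_power' Suc_le_eq)
  qed
  have "\<exists>i\<in>{1..k}. p ^ (2 * j) \<in> pair_differences ?n (a i) (b i)" if "j \<le> k" for j
    using val[of "2 * j"] that D by auto
  then obtain f where f: "f j \<in> {1..k}" "p ^ (2 * j) \<in> pair_differences ?n (a (f j)) (b (f j))"
    if "j \<le> k" for j
    by metis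
  have "\<not> inj_on f {0..k}"
  proof
    assume "inj_on f {0..k}"
    moreover have "f ` {0..k} \<subseteq> {1..k}"
      using f(1) by (intro image_subsetI) (simp only: atLeastAtMost_iff)
    ultimately have "card {0..k} \<le> card {1..k}"
      using finite_atLeastAtMost by (rule card_inj_on_le)
    then show False by simp
  qed
  then obtain i j where ij: "i < j" "j \<le> k" "f i = f j"
    using linorder_inj_onI'[of "{0..k}" f] atLeastAtMost_iff by blast
  have "p ^ (2 * i) \<in> pair_differences ?n (a (f j)) (b (f j))"
    using f(2)[of i] ij(1,2) unfolding ij(3) by linarith
  moreover have "p ^ (2 * j) \<in> pair_differences ?n (a (f j)) (b (f j))"
    using ij(2) by (rule f(2))
  moreover have "p ^ (2 * i) dvd p ^ (2 * i + 1)" "p ^ (2 * i + 1) dvd p ^ (2 * j)"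
    using ij(1) by (intro le_imp_power_dvd; linarith)+
  ultimately have "p ^ (2 * i + 1) \<in> pair_differences ?n (a (f j)) (b (f j))"
    by (rule pair_differences_convex)
  then have "p ^ (2 * i + 1) \<in> ?D"
    unfolding D using f(1)[OF ij(2)] by blast
  then show False
    using val[of "2 * i + 1"] ij by simp
qed

theorem proposition5p4:
  shows "\<forall>k::nat. \<exists>(n::nat) D. n > 0 \<and> connection_set n D \<and>
           P4_free (circulant n D) \<and> \<not> k_paired k n D"
proof
  fix k :: nat
  let ?n = "2 ^ (2 * k + 1) :: nat" and ?D = "valuation_set 2 (2 * k + 1) {e. even e}"
  have "0 < ?n \<and> connection_set ?n ?D \<and> P4_free (circulant ?n ?D) \<and> \<not> k_paired k ?n ?D"
    by (intro conjI connection_set_valuation_set P4_free_valuation_circulant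
        even_valuation_not_k_paired) simp_all
  then show "\<exists>(n::nat) D. n > 0 \<and> connection_set n D \<and>
      P4_free (circulant n D) \<and> \<not> k_paired k n D"
    by blast
qed

end
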